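(* Let $f=R'$, with $R$ rational, be an exact rational function of degree three. Up to translation of the source coordinate, $f$ belongs to one of the following three classes: (i) a cubic polynomial; (ii) one finite triple pole and no pole at infinity, $f(z)=c+\dfrac{a}{z^3}+\dfrac{b}{z^2}$, $a\neq0$; (iii) one finite double pole and a simple pole at infinity, $f(z)=az+b+\dfrac{c}{z^2}$, $ac\neq0$. For a generic member of each class, all singularities of $f^{-1}(\mathbb{RP}^1)\subset\mathbb{CP}^1$ are the forced pole-vertices; additional finite singularities occur exactly when a remaining critical value of $f$ lies on $\mathbb{RP}^1$.
   Context: The degree of $f$ is its degree as a rational map $\mathbb{CP}^1\to\mathbb{CP}^1$. A rational function $f$ is exact if $f=R'$ for some rational $R$, equivalently if $f(z)\,dz$ has zero residues. $\mathbb{RP}^1=\mathbb{R}\cup\{\infty\}\subset\mathbb{CP}^1$. The forced pole-vertices are the poles of $f$: a pole of order $m$ is a point of $f^{-1}(\mathbb{RP}^1)$ with $m$ smooth analytic branches (so $2m$ tangent rays). A "finite singularity" is a singular point of $f^{-1}(\mathbb{RP}^1)$ at which $f$ takes a finite value, i.e. one that is not a pole of $f$. The "remaining critical values" are the critical values of $f$ at critical points that are not poles of $f$ (the critical value at a multiple pole being forced to be $\infty$). "Generic" means outside a subset of real codimension at least one (a proper real algebraic or semialgebraic subset) of the coefficient space of the class. *)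

theory Defs
  imports
    "HOL-Complex_Analysis.Complex_Analysis"
    "HOL-Computational_Algebra.Computational_Algebra"
    "HOL-Computational_Algebra.Field_as_Ring"
begin

section \<open>The Riemann sphere\<close>

datatype cp1 = Pt (affine: complex) | Infty

definition RP1 :: "cp1 set" where
  "RP1 = insert Infty (range (\<lambda>t::real. Pt (complex_of_real t)))"

text \<open>The involution $z \mapsto 1/z$ of the sphere.\<close>

fun cp1_inv :: "cp1 \<Rightarrow> cp1" where
  "cp1_inv (Pt z) = (if z = 0 then Infty else Pt (1 / z))"
| "cp1_inv Infty = Pt 0"

text \<open>The standard holomorphic coordinate centred at a point: $w \mapsto z + w$ at a finite
  point $z$ and $w \mapsto 1/w$ at infinity.\<close>

fun local_chart :: "cp1 \<Rightarrow> complex \<Rightarrow> cp1" where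
  "local_chart (Pt z) w = Pt (z + w)"
| "local_chart Infty w = cp1_inv (Pt w)"

text \<open>Near a regular point the set is one embedded real-analytic arc with nonvanishing
  velocity.  Real-analytic maps of an open interval are the restrictions to the interval of maps
  that are holomorphic on a neighbourhood of it in the complex plane.  Requiring a homeomorphism,
  and not just a bijection, excludes an arc whose end returns to its own interior.\<close>

definition regular_arc_at :: "complex set \<Rightarrow> complex \<Rightarrow> bool" where
  "regular_arc_at X p \<longleftrightarrow>
     (\<exists>U e \<gamma> \<delta>. open U \<and> p \<in> U \<and> e > 0 \<and>
        \<gamma> analytic_on (complex_of_real ` {-e<..<e}) \<and> \<gamma> 0 = p \<and>
        (\<forall>t\<in>{-e<..<e}. deriv \<gamma> (complex_of_real t) \<noteq> 0) \<and>
        homeomorphism (complex_of_real ` {-e<..<e}) (X \<inter> U) \<gamma> \<delta>)"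

definition singular_points :: "cp1 set \<Rightarrow> cp1 set" where
  "singular_points X = {x \<in> X. \<not> regular_arc_at {w. local_chart x w \<in> X} 0}"

section \<open>Rational functions as maps of the sphere\<close>

type_synonym ratfun = "complex poly fract"

text \<open>The representation in lowest terms, with monic denominator.\<close>

definition rat_num :: "ratfun \<Rightarrow> complex poly" where
  "rat_num f = fst (quot_of_fract f)"

definition rat_den :: "ratfun \<Rightarrow> complex poly" where
  "rat_den f = snd (quot_of_fract f)"

definition rat_degree :: "ratfun \<Rightarrow> nat" where
  "rat_degree f = max (degree (rat_num f)) (degree (rat_den f))"

fun rat_map :: "ratfun \<Rightarrow> cp1 \<Rightarrow> cp1" where
  "rat_map f (Pt z) =
     (if poly (rat_den f) z = 0 then Infty
      else Pt (poly (rat_num f) z / poly (rat_den f) z))"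
| "rat_map f Infty =
     (if degree (rat_num f) > degree (rat_den f) then Infty
      else Pt (coeff (rat_num f) (degree (rat_den f)) / lead_coeff (rat_den f)))"

definition rat_deriv :: "ratfun \<Rightarrow> ratfun" where
  "rat_deriv f =
     Fract (pderiv (rat_num f) * rat_den f - rat_num f * pderiv (rat_den f)) (rat_den f ^ 2)"

definition rat_exact :: "ratfun \<Rightarrow> bool" where
  "rat_exact f \<longleftrightarrow> (\<exists>R. f = rat_deriv R)"

text \<open>The function $z \mapsto f(z + t)$.\<close>

definition rat_translate :: "complex \<Rightarrow> ratfun \<Rightarrow> ratfun" where
  "rat_translate t f = Fract (pcompose (rat_num f) [:t, 1:]) (pcompose (rat_den f) [:t, 1:])"

definition poles :: "ratfun \<Rightarrow> cp1 set" where
  "poles f = {x. rat_map f x = Infty}"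

text \<open>The order is 0 at points that are not poles (at infinity because of truncated
  subtraction).\<close>

fun pole_order :: "ratfun \<Rightarrow> cp1 \<Rightarrow> nat" where
  "pole_order f (Pt z) = order z (rat_den f)"
| "pole_order f Infty = degree (rat_num f) - degree (rat_den f)"

text \<open>The expression of $f$ in the local coordinate $w$ at a point; at a pole the coordinate of
  the target is that of infinity, so that $1/f$ is differentiated.\<close>

definition local_expr :: "ratfun \<Rightarrow> cp1 \<Rightarrow> complex \<Rightarrow> complex" where
  "local_expr f x w =
     (if x \<in> poles f then affine (cp1_inv (rat_map f (local_chart x w)))
      else affine (rat_map f (local_chart x w)))"

definition critical_points :: "ratfun \<Rightarrow> cp1 set" where
  "critical_points f = {x. (local_expr f x has_field_derivative 0) (at 0)}"

definition remaining_critical_values :: "ratfun \<Rightarrow> cp1 set" where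
  "remaining_critical_values f = rat_map f ` (critical_points f - poles f)"

definition real_locus :: "ratfun \<Rightarrow> cp1 set" where
  "real_locus f = rat_map f -` RP1"

definition finite_singularities :: "ratfun \<Rightarrow> cp1 set" where
  "finite_singularities f = singular_points (real_locus f) - poles f"

text \<open>Every singularity is a pole, and every pole that is forced to be singular is one.  At a
  pole of order $m$ the real locus has $m$ smooth branches, so a simple pole is a vertex but
  not a singularity.\<close>

definition only_forced_singularities :: "ratfun \<Rightarrow> bool" where
  "only_forced_singularities f \<longleftrightarrow>
     singular_points (real_locus f) = {x \<in> poles f. pole_order f x \<ge> 2}"

section \<open>The three classes and genericity\<close>

abbreviation ratC :: "complex \<Rightarrow> ratfun" where "ratC c \<equiv> to_fract [:c:]"

abbreviation ratZ :: ratfun where "ratZ \<equiv> to_fract [:0, 1:]"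

definition coeffs_i :: "(complex \<times> complex \<times> complex \<times> complex) set" where
  "coeffs_i = {(a, b, c, d). a \<noteq> 0}"

definition class_i :: "complex \<times> complex \<times> complex \<times> complex \<Rightarrow> ratfun" where
  "class_i = (\<lambda>(a, b, c, d). ratC a * ratZ ^ 3 + ratC b * ratZ ^ 2 + ratC c * ratZ + ratC d)"

definition coeffs_ii :: "(complex \<times> complex \<times> complex) set" where
  "coeffs_ii = {(a, b, c). a \<noteq> 0}"

definition class_ii :: "complex \<times> complex \<times> complex \<Rightarrow> ratfun" where
  "class_ii = (\<lambda>(a, b, c). ratC c + ratC a / ratZ ^ 3 + ratC b / ratZ ^ 2)"

definition coeffs_iii :: "(complex \<times> complex \<times> complex) set" where
  "coeffs_iii = {(a, b, c). a * c \<noteq> 0}"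

definition class_iii :: "complex \<times> complex \<times> complex \<Rightarrow> ratfun" where
  "class_iii = (\<lambda>(a, b, c). ratC a * ratZ + ratC b + ratC c / ratZ ^ 2)"

text \<open>The property holds outside a proper real algebraic subset of the coefficient space.  On a
  product of copies of the complex plane, the functions satisfying
  \<^const>\<open>real_polynomial_function\<close> are the real polynomials in the real and imaginary parts of
  the coordinates.  A single polynomial suffices, as a common zero set of several real polynomials
  is the zero set of their sum of squares.\<close>

definition generic_on :: "'a::real_normed_vector set \<Rightarrow> ('a \<Rightarrow> bool) \<Rightarrow> bool" where
  "generic_on S Q \<longleftrightarrow>
     (\<exists>P. real_polynomial_function P \<and> (\<exists>v\<in>S. P v \<noteq> 0) \<and> (\<forall>v\<in>S. P v \<noteq> 0 \<longrightarrow> Q v))"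

end

theory Submission
  imports Defs
begin

text \<open>In the coordinate \<open>w\<close> at a point \<open>x\<close> of the sphere, \<open>f\<close> (at a pole, \<open>1/f\<close>) is a holomorphic
  function \<open>\<phi>\<close>, and the real locus is the preimage of the reals.  It is a regular arc exactly when
  \<open>\<phi>'(0) \<noteq> 0\<close>: in one direction by the inverse function theorem, in the other because a zero of
  \<open>\<phi> - \<phi>(0)\<close> of order at least two would make \<open>Im \<phi>\<close> change sign on one side of the arc.
  Hence the singularities are the critical points on the locus.  A pole of order \<open>m\<close> is critical iff
  \<open>m \<ge> 2\<close>, so it remains that generically no remaining critical value is real, which follows from
  the non-vanishing of an explicit polynomial.
  The finite poles of a derivative have order at least two, so a derivative of degree three has at most
  one of them.\<close>

section \<open>Regular arcs in the preimage of the reals\<close>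

text \<open>If \<open>deriv G 0 = 0\<close>, then \<open>H = G - G 0\<close> equals
  \<open>s ^ n * g s\<close> near 0, with \<open>n \<ge> 2\<close> and \<open>g 0\<close> real and
  nonzero. The open upper half-disc then contains directions in which the leading term is a positive
  and a negative multiple of \<open>\<i>\<close>, so by connectedness \<open>Im H\<close> vanishes
  at a non-real point.\<close>

lemma deriv_nonzero_if_real_iff:
  fixes G :: "complex \<Rightarrow> complex"
  assumes hol: "G holomorphic_on ball 0 r" and r: "r > 0"
    and iff: "\<And>s. s \<in> ball 0 r \<Longrightarrow> G s \<in> \<real> \<longleftrightarrow> s \<in> \<real>"
  shows "deriv G 0 \<noteq> 0"
proof
  assume d0: "deriv G 0 = 0"
  define H where "H = (\<lambda>s. G s - G 0)"
  have holH: "H holomorphic_on ball 0 r"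
    unfolding H_def by (intro holomorphic_intros hol)
  have G0: "G 0 \<in> \<real>" using iff[of 0] r by simp
  have iffH: "H s \<in> \<real> \<longleftrightarrow> s \<in> \<real>" if "s \<in> ball 0 r" for s
  proof -
    have "H s \<in> \<real> \<longleftrightarrow> G s \<in> \<real>"
      using G0 unfolding H_def by (metis Reals_add Reals_diff diff_add_cancel)
    then show ?thesis using iff[OF that] by simp
  qed
  have nonconst: "\<not> H constant_on ball 0 r"
  proof
    assume "H constant_on ball 0 r"
    then obtain c where c: "\<And>s. s \<in> ball 0 r \<Longrightarrow> H s = c"
      unfolding constant_on_def by blast
    have "H (\<i> * of_real (r/2)) = H 0"
      using c[of 0] c[of "\<i> * of_real (r/2)"] r by (simp add: norm_mult)
    then have "\<i> * of_real (r/2) \<in> \<real>"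
      using iffH[of 0] iffH[of "\<i> * of_real (r/2)"] r by (simp add: norm_mult)
    then show False using r by (simp add: complex_is_Real_iff)
  qed
  have H0: "H 0 = 0" by (simp add: H_def)
  have zero: "0 \<in> ball (0::complex) r" using r by simp
  obtain g :: "complex \<Rightarrow> complex" and \<rho> :: real and n :: nat where n: "0 < n" and \<rho>: "0 < \<rho>" "ball 0 \<rho> \<subseteq> ball (0::complex) r"
    and holg: "g holomorphic_on ball 0 \<rho>"
    and fac: "\<And>w. w \<in> ball 0 \<rho> \<Longrightarrow> H w = (w - 0) ^ n * g w"
    and g0: "\<And>w. w \<in> ball 0 \<rho> \<Longrightarrow> g w \<noteq> 0"
    by (rule holomorphic_factor_zero_nonconstant[OF holH open_ball connected_ball zero H0 nonconst])
       (rule that)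
  have contg: "isCont g 0"
    using holg \<rho>(1) by (meson centre_in_ball continuous_on_eq_continuous_at holomorphic_on_imp_continuous_on open_ball)
  have "n \<noteq> 1"
  proof
    assume n1: "n = 1"
    have "(H has_field_derivative deriv G 0) (at 0)"
      unfolding H_def using holomorphic_derivI[OF hol open_ball, of 0] r
      by (auto intro!: derivative_eq_intros)
    moreover have "(H has_field_derivative g 0) (at 0)"
    proof -
      have dg: "(g has_field_derivative deriv g 0) (at 0)"
        using holomorphic_derivI[OF holg open_ball, of 0] \<rho> by simp
      have "((\<lambda>w. w * g w) has_field_derivative g 0) (at 0)"
        by (rule derivative_eq_intros dg refl)+ simp
      then show ?thesis
        by (rule has_field_derivative_transform_within_open[OF _ open_ball, of _ _ _ 0 \<rho>])
           (use \<rho> fac n1 in auto)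
    qed
    ultimately have "g 0 = 0" using d0 DERIV_unique by metis
    then show False using g0[of 0] \<rho> by simp
  qed
  with n have n2: "n \<ge> 2" by simp
  \<comment> \<open>Up to the positive factor \<open>t ^ n\<close>, this is \<open>H\<close> along
    the ray in direction \<open>\<omega>\<close>; a nonzero imaginary part of the limit fixes the
    sign of \<open>Im H\<close> near 0 on that ray.\<close>
  have lim: "((\<lambda>t. \<omega> ^ n * g (of_real t * \<omega>)) \<longlongrightarrow> \<omega> ^ n * g 0) (at_right (0::real))" for \<omega>
  proof -
    have "((\<lambda>t. of_real t * \<omega>) \<longlongrightarrow> of_real 0 * \<omega>) (at_right (0::real))"
      by (intro tendsto_intros)
    then have "((\<lambda>t. g (of_real t * \<omega>)) \<longlongrightarrow> g 0) (at_right (0::real))"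
      using isCont_tendsto_compose[OF contg] by simp
    then show ?thesis by (intro tendsto_intros)
  qed
  have small: "eventually (\<lambda>t::real. t > 0 \<and> t < \<rho>) (at_right 0)"
    using \<rho>(1) unfolding eventually_at_right_field by blast
  have Hray: "H (of_real t * \<omega>) = of_real (t ^ n) * (\<omega> ^ n * g (of_real t * \<omega>))"
    if "0 < t" "t < \<rho>" "norm \<omega> = 1" for t \<omega>
    using fac[of "of_real t * \<omega>"] that by (simp add: norm_mult power_mult_distrib)
  \<comment> \<open>On the positive real axis \<open>H\<close> is real, hence so is
    \<open>g\<close>, and the reals are closed.\<close>
  have g0R: "g 0 \<in> \<real>"
  proof -
    have "eventually (\<lambda>t. 1 ^ n * g (of_real t * 1) \<in> \<real>) (at_right (0::real))"
      using small
    proof eventually_elim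
      case (elim t)
      have "of_real t \<in> ball (0::complex) r"
        using elim by (intro subsetD[OF \<rho>(2)]) simp
      then have "H (of_real t) \<in> \<real>" using iffH by simp
      then have "of_real (inverse (t ^ n)) * H (of_real t) \<in> \<real>" by (intro Reals_mult) auto
      moreover have "of_real (inverse (t ^ n)) * H (of_real t) = 1 ^ n * g (of_real t * 1)"
        using Hray[of t 1] elim by simp
      ultimately show ?case by simp
    qed
    then have "1 ^ n * g 0 \<in> \<real>"
      by (rule Lim_in_closed_set[OF closed_complex_Reals _ trivial_limit_at_right_real lim])
    then show ?thesis by simp
  qed
  then obtain c where c: "g 0 = of_real c" by (auto elim: Reals_cases)
  have c0: "c \<noteq> 0" using g0[of 0] c \<rho> by auto
  \<comment> \<open>The factor \<open>\<epsilon>\<close> only encodes the wanted sign; it becomes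
    \<open>c\<close> and \<open>-c\<close> below.\<close>
  have sgn: "\<exists>s. s \<in> ball 0 r \<and> Im s > 0 \<and> Im (H s) * \<epsilon> > 0"
    if \<epsilon>: "Im (\<omega> ^ n * g 0) * \<epsilon> > 0" and \<omega>: "norm \<omega> = 1" "Im \<omega> > 0" for \<epsilon> \<omega>
  proof -
    have "((\<lambda>t. Im (\<omega> ^ n * g (of_real t * \<omega>)) * \<epsilon>) \<longlongrightarrow> Im (\<omega> ^ n * g 0) * \<epsilon>) (at_right 0)"
      by (intro tendsto_intros lim)
    then have "eventually (\<lambda>t. Im (\<omega> ^ n * g (of_real t * \<omega>)) * \<epsilon> > 0) (at_right 0)"
      using \<epsilon> order_tendstoD(1) by blast
    with small have "eventually (\<lambda>t. t > 0 \<and> t < \<rho> \<and> Im (\<omega> ^ n * g (of_real t * \<omega>)) * \<epsilon> > 0) (at_right 0)"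
      by eventually_elim auto
    then obtain t where t: "t > 0" "t < \<rho>" "Im (\<omega> ^ n * g (of_real t * \<omega>)) * \<epsilon> > 0"
      using eventually_happens trivial_limit_at_right_real by blast
    have inr: "of_real t * \<omega> \<in> ball 0 r"
      using t \<omega> by (intro subsetD[OF \<rho>(2)]) (simp add: norm_mult)
    have eq: "Im (H (of_real t * \<omega>)) * \<epsilon> = t ^ n * (Im (\<omega> ^ n * g (of_real t * \<omega>)) * \<epsilon>)"
      using Hray[OF t(1,2) \<omega>(1)] by (simp only: Im_complex_of_real times_complex.simps Re_complex_of_real) simp
    have "0 < t ^ n * (Im (\<omega> ^ n * g (of_real t * \<omega>)) * \<epsilon>)"
      by (rule mult_pos_pos[OF zero_less_power[OF t(1)] t(3)])
    then have "Im (H (of_real t * \<omega>)) * \<epsilon> > 0" by (simp only: eq)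
    moreover have "Im (of_real t * \<omega>) > 0" using t \<omega> by simp
    ultimately show ?thesis using inr by blast
  qed
  \<comment> \<open>Directions whose \<open>n\<close>-th powers are \<open>\<i>\<close> and
    \<open>- \<i>\<close>; the larger angle stays below \<open>pi\<close> because
    \<open>n \<ge> 2\<close>.\<close>
  have pw: "cis (pi / (2 * n)) ^ n = \<i>" "cis (3 * pi / (2 * n)) ^ n = - \<i>"
  proof -
    have "real n * (pi / (2 * n)) = pi / 2" using n by simp
    then show "cis (pi / (2 * n)) ^ n = \<i>" by (simp only: Complex.DeMoivre cis_pi_half)
    have "cis (3 * pi / (2 * n)) ^ n = cis (pi + pi / 2)"
      unfolding Complex.DeMoivre by (rule arg_cong[of _ _ cis]) (use n in \<open>simp add: field_simps\<close>)
    also have "\<dots> = - \<i>" by (simp only: cis_mult[symmetric]) simp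
    finally show "cis (3 * pi / (2 * n)) ^ n = - \<i>" .
  qed
  have im: "Im (cis (pi / (2 * n))) > 0" "Im (cis (3 * pi / (2 * n))) > 0"
    using n2 by (auto intro!: sin_gt_zero simp: field_simps)
  have "c * c > 0" using c0 by (metis not_real_square_gt_zero)
  then have "Im (cis (pi / (2 * n)) ^ n * g 0) * c > 0" "Im (cis (3 * pi / (2 * n)) ^ n * g 0) * (-c) > 0"
    unfolding pw c by simp_all
  then obtain s1 s2 where s1: "s1 \<in> ball 0 r" "Im s1 > 0" "Im (H s1) * c > 0"
    and s2: "s2 \<in> ball 0 r" "Im s2 > 0" "Im (H s2) * (-c) > 0"
    using sgn im norm_cis by meson
  define S where "S = ball 0 r \<inter> {s. Im s > 0}"
  have "connected S" unfolding S_def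
    by (intro convex_connected convex_Int convex_ball convex_halfspace_Im_gt)
  moreover have "continuous_on S (\<lambda>s. Im (H s) * c)"
    unfolding S_def
    by (intro continuous_intros continuous_on_subset[OF holomorphic_on_imp_continuous_on[OF holH]]) auto
  ultimately have "connected ((\<lambda>s. Im (H s) * c) ` S)" by (rule connected_continuous_image[rotated])
  then have "0 \<in> (\<lambda>s. Im (H s) * c) ` S"
    by (rule connectedD_interval[of _ "Im (H s2) * c" "Im (H s1) * c"]) (use s1 s2 in \<open>auto simp: S_def\<close>)
  then obtain s where "s \<in> S" "Im (H s) = 0" using c0 by auto
  then show False using iffH[of s] by (auto simp: S_def complex_is_Real_iff)
qed

text \<open>A local inverse \<open>\<psi>\<close> of \<open>\<phi>\<close> carries a real interval
  around the real number \<open>\<phi> p\<close> onto the arc, and \<open>\<phi> - \<phi> p\<close>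
  recovers the parameter.\<close>

lemma regular_arc_if_deriv_nonzero:
  assumes hol: "\<phi> holomorphic_on S" and S: "open S" "p \<in> S"
    and X: "\<And>w. w \<in> S \<Longrightarrow> w \<in> X \<longleftrightarrow> \<phi> w \<in> \<real>"
    and p: "\<phi> p \<in> \<real>" and d: "deriv \<phi> p \<noteq> 0"
  shows "regular_arc_at X p"
proof -
  obtain r where r: "r > 0" "ball p r \<subseteq> S" "open (\<phi> ` ball p r)" "inj_on \<phi> (ball p r)"
    using has_complex_derivative_locally_invertible[OF hol S(2,1) d] by metis
  have holB: "\<phi> holomorphic_on ball p r" using hol r holomorphic_on_subset by blast
  obtain \<psi> where \<psi>: "\<psi> holomorphic_on (\<phi> ` ball p r)"
    and d\<psi>: "\<And>z. z \<in> ball p r \<Longrightarrow> deriv \<phi> z * deriv \<psi> (\<phi> z) = 1"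
    and inv: "\<And>z. z \<in> ball p r \<Longrightarrow> \<psi> (\<phi> z) = z"
    using holomorphic_has_inverse[OF holB open_ball r(4)] by metis
  obtain e where e: "e > 0" "ball (\<phi> p) e \<subseteq> \<phi> ` ball p r"
    using r open_contains_ball by (metis centre_in_ball imageI)
  \<comment> \<open>Restricting the values of \<open>\<phi>\<close> to a disc makes
    \<open>X \<inter> U\<close> correspond to the full parameter interval and nothing more.\<close>
  define U where "U = {w \<in> ball p r. \<phi> w \<in> ball (\<phi> p) e}"
  define \<gamma> where "\<gamma> = (\<lambda>s. \<psi> (\<phi> p + s))"
  define \<delta> where "\<delta> = (\<lambda>w. \<phi> w - \<phi> p)"
  have inU: "\<psi> y \<in> U \<and> \<phi> (\<psi> y) = y" if "y \<in> ball (\<phi> p) e" for y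
    using that e inv by (force simp: U_def)
  have "open U" unfolding U_def
    using continuous_open_preimage[OF holomorphic_on_imp_continuous_on[OF holB] open_ball open_ball, of "\<phi> p" e]
    by (simp add: vimage_def Int_def conj_commute)
  moreover have "p \<in> U" using e r by (simp add: U_def)
  moreover have hol\<gamma>: "\<gamma> holomorphic_on ball 0 e"
    unfolding \<gamma>_def
    by (rule holomorphic_on_compose_gen[of "\<lambda>s. \<phi> p + s" _ \<psi> "ball (\<phi> p) e", unfolded o_def])
       (auto intro!: holomorphic_intros holomorphic_on_subset[OF \<psi>] e(2) simp: dist_norm)
  have ana: "\<gamma> analytic_on (complex_of_real ` {-e<..<e})"
    by (rule analytic_on_subset[of _ "ball 0 e"])
       (use hol\<gamma> in \<open>auto simp: analytic_on_open\<close>)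
  moreover have "deriv \<gamma> (complex_of_real t) \<noteq> 0" if t: "t \<in> {-e<..<e}" for t
  proof -
    have y: "\<phi> p + of_real t \<in> ball (\<phi> p) e" using t by (auto simp: dist_norm)
    have d1: "(\<psi> has_field_derivative deriv \<psi> (\<phi> p + of_real t)) (at (\<phi> p + of_real t))"
      using holomorphic_derivI[OF \<psi> r(3)] y e by blast
    have "(\<gamma> has_field_derivative deriv \<psi> (\<phi> p + of_real t) * 1) (at (of_real t))"
      unfolding \<gamma>_def by (rule DERIV_chain2[where f = \<psi> and g = "\<lambda>s. \<phi> p + s", OF d1]) (auto intro!: derivative_eq_intros)
    then have "deriv \<gamma> (of_real t) = deriv \<psi> (\<phi> p + of_real t)"
      using DERIV_imp_deriv by fastforce
    moreover have "deriv \<psi> (\<phi> p + of_real t) \<noteq> 0"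
      using d\<psi>[of "\<psi> (\<phi> p + of_real t)"] inU[OF y] by (auto simp: U_def)
    ultimately show ?thesis by simp
  qed
  moreover have "homeomorphism (complex_of_real ` {-e<..<e}) (X \<inter> U) \<gamma> \<delta>"
  proof (rule homeomorphismI)
    show "continuous_on (complex_of_real ` {-e<..<e}) \<gamma>"
      using ana analytic_imp_holomorphic holomorphic_on_imp_continuous_on by blast
    show "continuous_on (X \<inter> U) \<delta>"
      unfolding \<delta>_def
      by (intro continuous_intros continuous_on_subset[OF holomorphic_on_imp_continuous_on[OF holB]])
         (auto simp: U_def)
    show "\<gamma> ` complex_of_real ` {-e<..<e} \<subseteq> X \<inter> U"
    proof clarify
      fix t assume "t \<in> {-e<..<e}"
      then have y: "\<phi> p + of_real t \<in> ball (\<phi> p) e" by (auto simp: dist_norm)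
      have "\<psi> (\<phi> p + of_real t) \<in> S" using inU[OF y] r by (auto simp: U_def)
      then show "\<gamma> (of_real t) \<in> X \<inter> U"
        using inU[OF y] X[of "\<psi> (\<phi> p + of_real t)"] p by (auto simp: \<gamma>_def)
    qed
    show "\<delta> ` (X \<inter> U) \<subseteq> complex_of_real ` {-e<..<e}"
    proof clarify
      fix w assume w: "w \<in> X" "w \<in> U"
      then have "\<phi> w \<in> \<real>" using X r by (auto simp: U_def)
      then obtain t where t: "\<delta> w = of_real t" using p unfolding \<delta>_def by (metis Reals_cases Reals_diff)
      have "norm (\<delta> w) < e" using w by (auto simp: U_def \<delta>_def dist_norm norm_minus_commute)
      then have "t \<in> {-e<..<e}" using t by auto
      then show "\<delta> w \<in> complex_of_real ` {-e<..<e}" using t by auto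
    qed
    show "\<delta> (\<gamma> s) = s" if "s \<in> complex_of_real ` {-e<..<e}" for s
    proof -
      have "\<phi> p + s \<in> ball (\<phi> p) e" using that by (auto simp: dist_norm)
      then show ?thesis using inU by (simp add: \<gamma>_def \<delta>_def)
    qed
    show "\<gamma> (\<delta> w) = w" if "w \<in> X \<inter> U" for w
      using that inv by (auto simp: \<gamma>_def \<delta>_def U_def)
  qed
  moreover have "\<gamma> 0 = p" using inv r by (simp add: \<gamma>_def)
  ultimately show ?thesis using e unfolding regular_arc_at_def by blast
qed

text \<open>In the holomorphic extension of the parameter of the arc, the preimage of the reals under
  \<open>\<phi>\<close> becomes the real axis.\<close>

lemma deriv_nonzero_if_regular_arc:
  assumes hol: "\<phi> holomorphic_on S" and S: "open S" "p \<in> S"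
    and X: "\<And>w. w \<in> S \<Longrightarrow> w \<in> X \<longleftrightarrow> \<phi> w \<in> \<real>"
    and arc: "regular_arc_at X p"
  shows "deriv \<phi> p \<noteq> 0"
proof -
  obtain U e \<gamma> \<delta> where U: "open U" "p \<in> U" and e: "e > 0"
    and ana: "\<gamma> analytic_on (complex_of_real ` {-e<..<e})" and \<gamma>0: "\<gamma> 0 = p"
    and d\<gamma>: "\<forall>t\<in>{-e<..<e}. deriv \<gamma> (complex_of_real t) \<noteq> 0"
    and hom: "homeomorphism (complex_of_real ` {-e<..<e}) (X \<inter> U) \<gamma> \<delta>"
    using arc unfolding regular_arc_at_def by blast
  have 0: "0 \<in> complex_of_real ` {-e<..<e}" using e by force
  obtain r0 where r0: "r0 > 0" "\<gamma> holomorphic_on ball 0 r0"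
    using ana 0 unfolding analytic_on_def by blast
  have d0: "deriv \<gamma> 0 \<noteq> 0" using d\<gamma> e by force
  \<comment> \<open>Injectivity on a complex disc allows a complex parameter \<open>s\<close> to be
    identified with the real one \<open>\<delta> (\<gamma> s)\<close>.\<close>
  obtain r1 where r1: "r1 > 0" "ball 0 r1 \<subseteq> ball (0::complex) r0" "inj_on \<gamma> (ball 0 r1)"
    using has_complex_derivative_locally_injective[OF r0(2) _ open_ball d0] r0(1) by auto
  have pX: "p \<in> X \<inter> U" using hom 0 \<gamma>0 unfolding homeomorphism_def by blast
  have \<delta>p: "\<delta> p = 0" using hom 0 \<gamma>0 unfolding homeomorphism_def by metis
  have "continuous_on (X \<inter> U) \<delta>" using hom by (simp add: homeomorphism_def)
  then obtain d where d: "d > 0" "\<And>w. w \<in> X \<inter> U \<Longrightarrow> dist w p < d \<Longrightarrow> dist (\<delta> w) (\<delta> p) < r1"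
    using pX r1(1) unfolding continuous_on_iff by blast
  have "open (S \<inter> U \<inter> ball p d)" using S U by auto
  then have op: "open (ball 0 r1 \<inter> \<gamma> -` (S \<inter> U \<inter> ball p d))"
    using r0 r1 by (intro continuous_open_preimage holomorphic_on_imp_continuous_on open_ball)
      (rule holomorphic_on_subset)
  have "0 \<in> ball 0 r1 \<inter> \<gamma> -` (S \<inter> U \<inter> ball p d)" using \<gamma>0 S U d r1 by simp
  then obtain r2 where r2: "r2 > 0" "ball 0 r2 \<subseteq> ball 0 r1 \<inter> \<gamma> -` (S \<inter> U \<inter> ball p d)"
    using op open_contains_ball by blast
  define r where "r = min r2 e"
  have r: "r > 0" using r2 e by (simp add: r_def)
  have sub: "ball 0 r \<subseteq> ball (0::complex) r2" by (auto simp: r_def)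
  have hol\<gamma>: "\<gamma> holomorphic_on ball 0 r"
    using r0(2) by (rule holomorphic_on_subset) (use sub r2 r1 in blast)
  have holG: "(\<lambda>s. \<phi> (\<gamma> s)) holomorphic_on ball 0 r"
    by (rule holomorphic_on_compose_gen[OF hol\<gamma> hol, unfolded o_def]) (use sub r2 in blast)
  have "deriv (\<lambda>s. \<phi> (\<gamma> s)) 0 \<noteq> 0"
  proof (rule deriv_nonzero_if_real_iff[OF holG r])
    fix s :: complex assume s: "s \<in> ball 0 r"
    then have gs: "\<gamma> s \<in> S" "\<gamma> s \<in> U" "\<gamma> s \<in> ball p d" and s1: "s \<in> ball 0 r1"
      using sub r2 by blast+
    have "\<gamma> s \<in> X \<longleftrightarrow> s \<in> \<real>"
    proof
      assume "s \<in> \<real>"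
      then obtain t where "s = of_real t" by (auto elim: Reals_cases)
      then have "s \<in> complex_of_real ` {-e<..<e}" using s by (intro image_eqI[of _ _ t]) (auto simp: r_def)
      then show "\<gamma> s \<in> X" using hom unfolding homeomorphism_def by blast
    next
      assume "\<gamma> s \<in> X"
      then have m: "\<gamma> s \<in> X \<inter> U" using gs by blast
      have "\<gamma> (\<delta> (\<gamma> s)) = \<gamma> s" using m hom unfolding homeomorphism_def by blast
      moreover have "\<delta> (\<gamma> s) \<in> ball 0 r1"
        using d(2)[OF m] gs \<delta>p by (simp add: dist_commute)
      ultimately have "\<delta> (\<gamma> s) = s" using r1(3) s1 by (meson inj_onD)
      moreover have "\<delta> (\<gamma> s) \<in> complex_of_real ` {-e<..<e}"
        using m hom unfolding homeomorphism_def by blast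
      ultimately show "s \<in> \<real>" by auto
    qed
    then show "\<phi> (\<gamma> s) \<in> \<real> \<longleftrightarrow> s \<in> \<real>" using X[OF gs(1)] by simp
  qed
  moreover have "deriv (\<lambda>s. \<phi> (\<gamma> s)) 0 = deriv \<phi> p * deriv \<gamma> 0"
  proof -
    have "(\<phi> has_field_derivative deriv \<phi> p) (at (\<gamma> 0))"
      using holomorphic_derivI[OF hol S(1)] S \<gamma>0 by simp
    moreover have "(\<gamma> has_field_derivative deriv \<gamma> 0) (at 0)"
      using holomorphic_derivI[OF hol\<gamma> open_ball, of 0] r by simp
    ultimately show ?thesis by (intro DERIV_imp_deriv DERIV_chain2[where f = \<phi> and g = \<gamma>])
  qed
  ultimately show ?thesis by auto
qed

section \<open>Exact rational functions of degree three\<close>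

lemma rat_den_nonzero: "rat_den f \<noteq> 0"
  by (simp add: rat_den_def)

lemma lead_coeff_rat_den: "lead_coeff (rat_den f) = 1"
proof -
  have "unit_factor (rat_den f) = 1"
    by (simp add: rat_den_def unit_factor_snd_quot_of_fract)
  then show ?thesis by (simp add: unit_factor_poly_def one_pCons)
qed

lemma coprime_rat_num_den: "coprime (rat_num f) (rat_den f)"
  by (simp add: rat_num_def rat_den_def coprime_quot_of_fract)

lemma Fract_rat_num_den: "Fract (rat_num f) (rat_den f) = f"
  by (simp add: rat_num_def rat_den_def)

lemma rat_num_den_Fract:
  assumes "coprime p q" "lead_coeff q = 1"
  shows "rat_num (Fract p q) = p" "rat_den (Fract p q) = q"
proof -
  have "unit_factor q = 1" using assms(2) by (simp add: unit_factor_poly_def one_pCons)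
  then have "(p, q) \<in> normalized_fracts" using assms(1) by (simp add: normalized_fracts_def)
  then have "quot_of_fract (quot_to_fract (p, q)) = (p, q)" by (rule quot_of_fract_quot_to_fract')
  then show "rat_num (Fract p q) = p" "rat_den (Fract p q) = q"
    by (simp_all add: rat_num_def rat_den_def quot_to_fract_def)
qed

lemma rat_num_den_roots: "poly (rat_num f) z \<noteq> 0 \<or> poly (rat_den f) z \<noteq> 0"
  using coprime_rat_num_den coprime_poly_0 by blast

text \<open>After splitting off all factors \<open>z - t\<close>, the cofactor has no root, so it is
  constant by the fundamental theorem of algebra, and monic.\<close>

lemma monic_single_root_eq_power:
  fixes p :: "complex poly"
  assumes monic: "lead_coeff p = 1" and root: "\<And>s. poly p s = 0 \<Longrightarrow> s = t"
  shows "p = [:-t, 1:] ^ order t p"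
proof -
  have p0: "p \<noteq> 0" using monic by auto
  then obtain r where r: "p = [:-t, 1:] ^ order t p * r" "\<not> [:-t, 1:] dvd r"
    using order_decomp by blast
  have "poly r s \<noteq> 0" for s
  proof
    assume "poly r s = 0"
    moreover from this have "poly p s = 0" by (subst r(1)) simp
    ultimately show False using root r(2) by (metis poly_eq_0_iff_dvd)
  qed
  then have "constant (poly r)" using fundamental_theorem_of_algebra by blast
  then have "degree r = 0" by (simp add: constant_degree)
  then obtain c where c: "r = [:c:]" by (auto elim: degree_eq_zeroE)
  have "lead_coeff p = lead_coeff ([:-t, 1:] ^ order t p) * lead_coeff r"
    using arg_cong[OF r(1), of lead_coeff] by (simp only: lead_coeff_mult)
  also have "\<dots> = c" by (simp add: lead_coeff_power c)
  finally show ?thesis using r(1) c monic by (simp add: one_pCons)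
qed

section \<open>Pole orders of a derivative\<close>

text \<open>The quotient rule need not give lowest terms, so orders are compared in this
  cross-multiplied identity.\<close>

lemma rat_deriv_num_den:
  assumes "f = rat_deriv R"
  shows "rat_num f * rat_den R ^ 2 =
    (pderiv (rat_num R) * rat_den R - rat_num R * pderiv (rat_den R)) * rat_den f"
proof -
  have "Fract (rat_num f) (rat_den f) =
      Fract (pderiv (rat_num R) * rat_den R - rat_num R * pderiv (rat_den R)) (rat_den R ^ 2)"
    using assms Fract_rat_num_den[of f] by (simp add: rat_deriv_def)
  then show ?thesis by (simp add: eq_fract rat_den_nonzero)
qed

lemma pderiv_nonzero_if_root:
  fixes p :: "complex poly"
  assumes "p \<noteq> 0" "poly p t = 0"
  shows "pderiv p \<noteq> 0"
proof
  assume "pderiv p = 0"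
  then have "degree p = 0" by (simp add: pderiv_eq_0_iff)
  then show False using assms by (auto elim!: degree_eq_zeroE)
qed

text \<open>In \<open>W = p' q - p q'\<close> the term \<open>p q'\<close> has order exactly
  \<open>k - 1\<close> at \<open>t\<close> and \<open>p' q\<close> at least \<open>k\<close>, so
  \<open>W\<close> has order \<open>k - 1\<close>. Comparing orders in the cross-multiplied identity
  gives the rest.\<close>

lemma order_rat_den_deriv:
  assumes f: "f = rat_deriv R" and k: "order t (rat_den R) \<noteq> 0"
  shows "order t (rat_den f) = Suc (order t (rat_den R))"
proof -
  let ?p = "rat_num R" and ?q = "rat_den R" and ?N = "rat_num f" and ?D = "rat_den f"
  define k where "k = order t ?q"
  define W where "W = pderiv ?p * ?q - ?p * pderiv ?q"
  have q0: "?q \<noteq> 0" by (rule rat_den_nonzero)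
  have qt: "poly ?q t = 0" using k by (simp add: order_root)
  then have pt: "poly ?p t \<noteq> 0" using rat_num_den_roots by blast
  then have p0: "?p \<noteq> 0" by auto
  have dq0: "pderiv ?q \<noteq> 0"
    by (rule pderiv_nonzero_if_root[OF q0 qt])
  have ordq: "k = Suc (order t (pderiv ?q))" unfolding k_def
    by (rule order_pderiv[OF q0 qt])
  have ordpq: "order t (?p * pderiv ?q) = k - 1"
    using p0 dq0 pt ordq by (simp add: order_mult order_0I)
  have d1: "[:-t, 1:] ^ k dvd pderiv ?p * ?q"
    using order_1[of t ?q] unfolding k_def by (rule dvd_mult)
  have "\<not> [:-t, 1:] ^ k dvd ?p * pderiv ?q"
    using ordpq ordq p0 dq0 by (simp add: order_divides del: power_Suc mult_pCons_left)
  then have nd: "\<not> [:-t, 1:] ^ k dvd W"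
    using d1 unfolding W_def by (metis dvd_diff diff_diff_eq2 add_diff_cancel_left')
  then have W0: "W \<noteq> 0" by auto
  have "[:-t, 1:] ^ (k - 1) dvd W" unfolding W_def
    using d1 ordpq by (intro dvd_diff) (auto simp: order_divides intro: dvd_trans[OF le_imp_power_dvd])
  then have ordW: "order t W = k - 1"
    using nd W0 by (simp add: order_divides)
  have eq: "?N * ?q ^ 2 = W * ?D" using rat_deriv_num_den[OF f] by (simp add: W_def)
  have N0: "?N \<noteq> 0" using eq W0 rat_den_nonzero by fastforce
  have "order t (?N * ?q ^ 2) = order t ?N + (k + k)"
    using N0 q0 by (simp add: order_mult power2_eq_square k_def)
  moreover have "order t (W * ?D) = (k - 1) + order t ?D"
    using W0 rat_den_nonzero by (simp add: order_mult ordW)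
  \<comment> \<open>This forces the denominator of \<open>f\<close> to vanish at \<open>t\<close>;
    the coprime numerator then does not, so its order drops out.\<close>
  ultimately have sum: "order t ?N + (k + k) = (k - 1) + order t ?D" using eq by simp
  then have "order t ?D \<noteq> 0" using ordq by linarith
  then have "poly ?D t = 0" by (simp add: order_root)
  then have "order t ?N = 0" using rat_num_den_roots order_0I by blast
  then show ?thesis using sum ordq by (simp add: k_def)
qed

lemma rat_den_deriv_root:
  assumes "f = rat_deriv R" "poly (rat_den f) s = 0"
  shows "poly (rat_den R) s = 0"
proof -
  have "poly (rat_num f) s \<noteq> 0" using assms(2) rat_num_den_roots by blast
  moreover have "poly (rat_num f * rat_den R ^ 2) s = 0"
    unfolding rat_deriv_num_den[OF assms(1)] using assms(2) by simp
  ultimately show ?thesis by simp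
qed

lemma order_rat_den_deriv_root:
  assumes "f = rat_deriv R" "poly (rat_den R) s = 0"
  shows "order s (rat_den f) = Suc (order s (rat_den R))" "order s (rat_den R) \<ge> 1"
    "poly (rat_den f) s = 0"
proof -
  show 1: "order s (rat_den R) \<ge> 1"
    using assms(2) rat_den_nonzero by (metis order_root less_one not_less)
  then show 2: "order s (rat_den f) = Suc (order s (rat_den R))"
    using order_rat_den_deriv[OF assms(1)] by simp
  then show "poly (rat_den f) s = 0" by (simp add: order_root)
qed

text \<open>Finite poles of a derivative have order at least two, so two of them would need a
  denominator of degree four. Hence the denominators of \<open>f\<close> and of its antiderivative
  \<open>R\<close> are powers of one linear factor; \<open>p\<close> is the numerator of
  \<open>R\<close>.\<close>

lemma rat_exact_single_pole:
  assumes ex: "rat_exact f" and deg: "degree (rat_den f) \<le> 3" and pole: "poly (rat_den f) t = 0"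
  obtains p k where "k \<ge> 1" "rat_den f = [:-t, 1:] ^ Suc k"
    "rat_num f = [:-t, 1:] * pderiv p - smult (of_nat k) p"
proof -
  obtain R where f: "f = rat_deriv R" using ex by (auto simp: rat_exact_def)
  define k where "k = order t (rat_den R)"
  have k1: "k \<ge> 1" and ord: "order t (rat_den f) = Suc k"
    using order_rat_den_deriv_root[OF f rat_den_deriv_root[OF f pole]] by (simp_all add: k_def)
  have uniq: "s = t" if s: "poly (rat_den f) s = 0" for s
  proof (rule ccontr)
    assume "s \<noteq> t"
    have "order s (rat_den f) + order t (rat_den f) = (\<Sum>x\<in>{s, t}. order x (rat_den f))"
      using \<open>s \<noteq> t\<close> by simp
    also have "\<dots> \<le> (\<Sum>x | poly (rat_den f) x = 0. order x (rat_den f))"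
      using s pole by (intro sum_mono2 poly_roots_finite rat_den_nonzero) auto
    also have "\<dots> \<le> 3" using sum_order_le_degree[OF rat_den_nonzero] deg by (rule order_trans)
    finally show False
      using ord k1 order_rat_den_deriv_root[OF f rat_den_deriv_root[OF f s]] by simp
  qed
  have D: "rat_den f = [:-t, 1:] ^ Suc k"
    using monic_single_root_eq_power[OF lead_coeff_rat_den uniq] ord by metis
  have q: "rat_den R = [:-t, 1:] ^ k"
    unfolding k_def
    by (rule monic_single_root_eq_power[OF lead_coeff_rat_den])
       (use uniq order_rat_den_deriv_root[OF f] in blast)
  obtain j where j: "k = Suc j" using k1 by (cases k) auto
  \<comment> \<open>With powers of \<open>z - t\<close> as denominators, the identity has the common
    factor \<open>(z - t)^(2 k)\<close>, which is finally cancelled.\<close>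
  have "rat_num f * [:-t, 1:] ^ (2 * k) =
    (pderiv (rat_num R) * [:-t, 1:] ^ k - rat_num R * (smult (of_nat k) ([:-t, 1:] ^ j))) * [:-t, 1:] ^ Suc k"
    using rat_deriv_num_den[OF f]
    by (simp only: D q j pderiv_power_Suc power_mult[symmetric] mult.commute[of _ 2])
       (simp add: pderiv_pCons)
  also have "\<dots> = ([:-t, 1:] * pderiv (rat_num R) - smult (of_nat k) (rat_num R)) * [:-t, 1:] ^ (2 * k)"
    unfolding j by (simp only: power_Suc mult_2 power_add add_Suc add_Suc_right) (simp only: ring_distribs mult_smult_left mult_smult_right mult_ac)
  finally have "rat_num f = [:-t, 1:] * pderiv (rat_num R) - smult (of_nat k) (rat_num R)"
    by simp
  then show ?thesis using that k1 D by blast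
qed

section \<open>Lowest terms, poles and pole orders of the three normal forms\<close>

lemma coprime_monomial:
  fixes p :: "complex poly"
  assumes "poly p 0 \<noteq> 0"
  shows "coprime p ([:0, 1:] ^ n)"
proof -
  have "coprime p [:0, 1:]"
  proof (rule coprimeI)
    fix c assume c: "c dvd p" "c dvd [:0, 1:]"
    \<comment> \<open>Writing \<open>p = a + z q\<close>, a common divisor with \<open>z\<close>
      divides the constant \<open>a = p(0)\<close>, a unit.\<close>
    obtain a q where p: "p = pCons a q" by (cases p)
    have "p = [:a:] + [:0, 1:] * q" by (simp add: p)
    then have "c dvd [:a:]" using c by (metis dvd_add_left_iff dvd_mult2)
    moreover have "[:a:] dvd 1" using assms by (simp add: p is_unit_const_poly_iff dvd_field_iff)
    ultimately show "is_unit c" by (rule dvd_trans)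
  qed
  then show ?thesis by simp
qed

lemma monomial_pCons:
  "[:0, 1::complex:] ^ 2 = [:0, 0, 1:]" "[:0, 1::complex:] ^ 3 = [:0, 0, 0, 1:]"
  by (simp_all add: power2_eq_square power3_eq_cube)

lemma class_i_Fract: "class_i (a, b, c, d) = Fract [:d, c, b, a:] 1"
  by (simp add: class_i_def to_fract_def power2_eq_square power3_eq_cube algebra_simps)

lemma class_ii_Fract: "class_ii (a, b, c) = Fract [:a, b, 0, c:] [:0, 0, 0, 1:]"
  by (simp add: class_ii_def to_fract_def power2_eq_square power3_eq_cube eq_fract)

lemma class_iii_Fract: "class_iii (a, b, c) = Fract [:c, 0, b, a:] [:0, 0, 1:]"
  by (simp add: class_iii_def to_fract_def power2_eq_square eq_fract)

lemma rat_class_i: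
  "rat_num (class_i (a, b, c, d)) = [:d, c, b, a:]" "rat_den (class_i (a, b, c, d)) = 1"
  unfolding class_i_Fract by (rule rat_num_den_Fract; simp)+

lemma rat_class_ii:
  assumes "a \<noteq> 0"
  shows "rat_num (class_ii (a, b, c)) = [:a, b, 0, c:]" "rat_den (class_ii (a, b, c)) = [:0, 0, 0, 1:]"
  using coprime_monomial[of "[:a, b, 0, c:]" 3] assms
  unfolding class_ii_Fract monomial_pCons by (intro rat_num_den_Fract; simp)+

lemma rat_class_iii:
  assumes "c \<noteq> 0"
  shows "rat_num (class_iii (a, b, c)) = [:c, 0, b, a:]" "rat_den (class_iii (a, b, c)) = [:0, 0, 1:]"
  using coprime_monomial[of "[:c, 0, b, a:]" 2] assms
  unfolding class_iii_Fract monomial_pCons by (intro rat_num_den_Fract; simp)+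

lemma poles_class_i: "a \<noteq> 0 \<Longrightarrow> poles (class_i (a, b, c, d)) = {Infty}"
proof -
  assume "a \<noteq> 0"
  then have "rat_map (class_i (a, b, c, d)) x = Infty \<longleftrightarrow> x = Infty" for x
    by (cases x) (simp_all add: rat_class_i)
  then show ?thesis by (auto simp: poles_def)
qed

lemma poles_class_ii: "a \<noteq> 0 \<Longrightarrow> poles (class_ii (a, b, c)) = {Pt 0}"
proof -
  assume a: "a \<noteq> 0"
  have "rat_map (class_ii (a, b, c)) x = Infty \<longleftrightarrow> x = Pt 0" for x
    by (cases x) (simp_all add: rat_class_ii[OF a])
  then show ?thesis by (auto simp: poles_def)
qed

lemma poles_class_iii: "a * c \<noteq> 0 \<Longrightarrow> poles (class_iii (a, b, c)) = {Pt 0, Infty}"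
proof -
  assume ac: "a * c \<noteq> 0"
  then have "rat_map (class_iii (a, b, c)) x = Infty \<longleftrightarrow> x = Pt 0 \<or> x = Infty" for x
    by (cases x) (simp_all add: rat_class_iii)
  then show ?thesis by (auto simp: poles_def)
qed

lemma pole_order_class_ii: "a \<noteq> 0 \<Longrightarrow> pole_order (class_ii (a, b, c)) (Pt 0) = 3"
  using order_power_n_n[of "0::complex" 3] by (simp add: rat_class_ii monomial_pCons)

lemma pole_order_class_iii:
  assumes "a * c \<noteq> 0"
  shows "pole_order (class_iii (a, b, c)) (Pt 0) = 2" "pole_order (class_iii (a, b, c)) Infty = 1"
  using order_power_n_n[of "0::complex" 2] assms by (simp_all add: rat_class_iii monomial_pCons)

section \<open>Classification up to translation\<close>

lemma poly_degree_le_3: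
  fixes p :: "complex poly"
  assumes "degree p \<le> 3"
  shows "p = [:coeff p 0, coeff p 1, coeff p 2, coeff p 3:]"
proof (rule poly_eqI)
  fix n :: nat
  consider "n = 0" | "n = 1" | "n = 2" | "n = 3" | "n > 3" by linarith
  then show "coeff p n = coeff [:coeff p 0, coeff p 1, coeff p 2, coeff p 3:] n"
    using assms by cases (auto simp: coeff_eq_0 coeff_pCons numeral_2_eq_2 numeral_3_eq_3 split: nat.split)
qed

lemma pcompose_linear_power_shift: "pcompose ([:-t, 1:] ^ n) [:t, 1:] = [:0, 1::complex:] ^ n"
  by (induction n) (simp_all add: pcompose_1 pcompose_mult pcompose_pCons del: mult_pCons_left)

lemma rat_translate_0: "rat_translate 0 f = f"
  by (simp add: rat_translate_def Fract_rat_num_den)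

text \<open>With a single finite pole at \<open>t\<close>, the antiderivative is \<open>p / (z - t)^k\<close>, and the numerator
  \<open>(z - t) p' - k p\<close> of its derivative has no term of degree \<open>k\<close> in \<open>z - t\<close>: this is the
  vanishing of the residue.\<close>

lemma rat_exact_single_pole_translate:
  assumes ex: "rat_exact f" and deg: "degree (rat_den f) \<le> 3" and pole: "poly (rat_den f) t = 0"
  obtains N k where "k \<ge> 1" "degree (rat_den f) = Suc k" "degree N = degree (rat_num f)"
    "rat_translate t f = Fract N ([:0, 1:] ^ Suc k)" "poly N 0 \<noteq> 0" "coeff N k = 0"
proof -
  obtain p k where k: "k \<ge> 1" and D: "rat_den f = [:-t, 1:] ^ Suc k"
    and N: "rat_num f = [:-t, 1:] * pderiv p - smult (of_nat k) p"
    using rat_exact_single_pole[OF assms] by metis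
  let ?p = "pcompose p [:t, 1:]"
  have "pcompose (rat_num f) [:t, 1:] = pCons 0 (pderiv ?p) - smult (of_nat k) ?p"
    by (simp add: N pcompose_diff pcompose_mult pcompose_smult pcompose_pCons pderiv_pcompose
        pderiv_pCons del: mult_pCons_left) simp
  then have "coeff (pcompose (rat_num f) [:t, 1:]) k = 0"
    using k by (cases k) (simp_all add: coeff_pderiv)
  moreover have "rat_translate t f = Fract (pcompose (rat_num f) [:t, 1:]) ([:0, 1:] ^ Suc k)"
    by (simp only: rat_translate_def D pcompose_linear_power_shift)
  moreover have "poly (pcompose (rat_num f) [:t, 1:]) 0 \<noteq> 0"
    using pole rat_num_den_roots[of f t] by (simp add: poly_pcompose)
  moreover have "degree (rat_den f) = Suc k" unfolding D degree_linear_power ..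
  moreover have "degree (pcompose (rat_num f) [:t, 1:]) = degree (rat_num f)"
    by (simp add: degree_pcompose)
  ultimately show ?thesis using that[OF k] by blast
qed

text \<open>Without finite poles \<open>f\<close> is a polynomial. Otherwise its denominator has
  degree \<open>k + 1\<close>, at most three, and the zero coefficient of index \<open>k\<close> in
  the translated numerator is the missing term of class (iii) for \<open>k = 1\<close> and of class
  (ii) for \<open>k = 2\<close>.\<close>

lemma exact_degree_3_classification:
  assumes ex: "rat_exact f" and deg: "rat_degree f = 3"
  shows "\<exists>t g. g = rat_translate t f \<and>
               (g \<in> class_i ` coeffs_i
                \<or> poles g = {Pt 0} \<and> pole_order g (Pt 0) = 3 \<and> g \<in> class_ii ` coeffs_ii
                \<or> poles g = {Pt 0, Infty} \<and> pole_order g (Pt 0) = 2 \<and> pole_order g Infty = 1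
                    \<and> g \<in> class_iii ` coeffs_iii)"
proof (cases "\<exists>t. poly (rat_den f) t = 0")
  case False
  then have "constant (poly (rat_den f))" using fundamental_theorem_of_algebra by blast
  then have d0: "degree (rat_den f) = 0" by (simp add: constant_degree)
  then have D: "rat_den f = 1"
    using lead_coeff_rat_den[of f] by (auto elim!: degree_eq_zeroE simp: one_pCons)
  have N3: "degree (rat_num f) = 3" using deg d0 by (simp add: rat_degree_def)
  define a b c d where "a = coeff (rat_num f) 3" and "b = coeff (rat_num f) 2"
    and "c = coeff (rat_num f) 1" and "d = coeff (rat_num f) 0"
  have "rat_num f = [:d, c, b, a:]"
    using poly_degree_le_3[of "rat_num f"] N3 by (simp add: a_def b_def c_def d_def)
  then have "f = class_i (a, b, c, d)" using Fract_rat_num_den[of f] by (simp add: class_i_Fract D)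
  moreover have "a \<noteq> 0" using N3 by (metis a_def leading_coeff_0_iff degree_0 zero_neq_numeral)
  ultimately have "f \<in> class_i ` coeffs_i" by (auto simp: coeffs_i_def)
  then show ?thesis by (intro exI[of _ 0] exI[of _ f]) (simp add: rat_translate_0)
next
  case True
  then obtain t where t: "poly (rat_den f) t = 0" ..
  have "degree (rat_den f) \<le> 3" using deg by (simp add: rat_degree_def)
  then obtain N k where k: "k \<ge> 1" "degree (rat_den f) = Suc k" and dN: "degree N = degree (rat_num f)"
    and g: "rat_translate t f = Fract N ([:0, 1:] ^ Suc k)" and N0: "poly N 0 \<noteq> 0" and Nk: "coeff N k = 0"
    using rat_exact_single_pole_translate[OF ex _ t] by metis
  have dle: "degree N \<le> 3" using deg dN by (simp add: rat_degree_def)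
  have c0: "coeff N 0 \<noteq> 0" using N0 by (simp add: poly_0_coeff_0)
  consider "k = 1" | "k = 2" using k deg by (fastforce simp: rat_degree_def)
  then show ?thesis
  proof cases
    case 1
    define a b c where "a = coeff N 3" and "b = coeff N 2" and "c = coeff N 0"
    have "N = [:c, 0, b, a:]"
      using poly_degree_le_3[OF dle] Nk 1 by (simp add: a_def b_def c_def)
    then have g': "rat_translate t f = class_iii (a, b, c)"
      using g 1 monomial_pCons by (simp add: class_iii_Fract)
    \<comment> \<open>The denominator has degree two, so the degree three of \<open>f\<close> comes
      from the numerator: this is the simple pole at infinity.\<close>
    have "degree N = 3" using deg k 1 dN by (simp add: rat_degree_def max_def split: if_splits)
    then have "a \<noteq> 0" by (metis a_def leading_coeff_0_iff degree_0 zero_neq_numeral)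
    then have ac: "a * c \<noteq> 0" using c0 by (simp add: c_def)
    then have "class_iii (a, b, c) \<in> class_iii ` coeffs_iii" by (intro imageI) (simp add: coeffs_iii_def)
    then show ?thesis
      unfolding g'[symmetric] using poles_class_iii[OF ac, of b] pole_order_class_iii[OF ac, of b]
      by (metis g')
  next
    case 2
    define a b c where "a = coeff N 0" and "b = coeff N 1" and "c = coeff N 3"
    have "N = [:a, b, 0, c:]"
      using poly_degree_le_3[OF dle] Nk 2 by (simp add: a_def b_def c_def)
    then have g': "rat_translate t f = class_ii (a, b, c)"
      using g 2 monomial_pCons by (simp add: class_ii_Fract)
    have a: "a \<noteq> 0" using c0 by (simp add: a_def)
    then have "class_ii (a, b, c) \<in> class_ii ` coeffs_ii" by (intro imageI) (simp add: coeffs_ii_def)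
    then show ?thesis
      using poles_class_ii[OF a, of b c] pole_order_class_ii[OF a, of b c] by (metis g')
  qed
qed

section \<open>The real locus near a point\<close>

lemma order_pcompose_shift:
  fixes p :: "complex poly"
  assumes "p \<noteq> 0"
  shows "order 0 (pcompose p [:z, 1:]) = order z p"
proof -
  obtain r where r: "p = [:-z, 1:] ^ order z p * r" "\<not> [:-z, 1:] dvd r"
    using order_decomp[OF assms] by blast
  have "pcompose p [:z, 1:] = [:0, 1:] ^ order z p * pcompose r [:z, 1:]"
    using arg_cong[OF r(1), of "\<lambda>p. pcompose p [:z, 1:]"] unfolding pcompose_mult pcompose_linear_power_shift .
  moreover have "poly (pcompose r [:z, 1:]) 0 \<noteq> 0"
    using r(2) by (simp add: poly_pcompose poly_eq_0_iff_dvd)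
  moreover have "order 0 ([:0, 1::complex:] ^ order z p) = order z p"
    using order_power_n_n[of "0::complex"] by simp
  moreover have "pcompose p [:z, 1:] \<noteq> 0" using assms by (simp add: pcompose_eq_0_iff)
  ultimately show ?thesis by (simp add: order_mult order_0I)
qed

text \<open>At a finite point numerator and denominator are shifted; at infinity
  \<open>1 / w\<close> is substituted and both are multiplied by \<open>w ^ n\<close>, with
  \<open>n\<close> the larger degree. They do not vanish together at 0, by coprimality in the first
  case and by the choice of \<open>n\<close> in the second.\<close>

lemma rat_map_local_chart:
  obtains P Q where "poly P 0 \<noteq> 0 \<or> poly Q 0 \<noteq> 0" "Q \<noteq> 0" "order 0 Q = pole_order f x"
    "\<And>w. rat_map f (local_chart x w) = (if poly Q w = 0 then Infty else Pt (poly P w / poly Q w))"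
proof (cases x)
  case (Pt z)
  show ?thesis
  proof (rule that)
    show "poly (pcompose (rat_num f) [:z, 1:]) 0 \<noteq> 0 \<or> poly (pcompose (rat_den f) [:z, 1:]) 0 \<noteq> 0"
      using rat_num_den_roots by (simp add: poly_pcompose)
    show "pcompose (rat_den f) [:z, 1:] \<noteq> 0" using rat_den_nonzero by (simp add: pcompose_eq_0_iff)
    show "order 0 (pcompose (rat_den f) [:z, 1:]) = pole_order f x"
      by (simp add: order_pcompose_shift rat_den_nonzero Pt)
    show "rat_map f (local_chart x w) = (if poly (pcompose (rat_den f) [:z, 1:]) w = 0 then Infty
      else Pt (poly (pcompose (rat_num f) [:z, 1:]) w / poly (pcompose (rat_den f) [:z, 1:]) w))" for w
      by (simp add: Pt poly_pcompose)
  qed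
next
  case Infty
  let ?N = "rat_num f" and ?D = "rat_den f"
  define n where "n = max (degree ?N) (degree ?D)"
  define P where "P = monom 1 (n - degree ?N) * reflect_poly ?N"
  define Q where "Q = monom 1 (n - degree ?D) * reflect_poly ?D"
  have D0: "poly (reflect_poly ?D) 0 = 1" using lead_coeff_rat_den by simp
  have P: "poly P w = w ^ n * poly ?N (1 / w)" and Q: "poly Q w = w ^ n * poly ?D (1 / w)"
    if "w \<noteq> 0" for w
    using that
    by (simp_all add: P_def Q_def poly_monom poly_reflect_poly_nz n_def inverse_eq_divide
        flip: mult.assoc power_add)
  have P0: "poly P 0 = (if degree ?N < degree ?D then 0 else lead_coeff ?N)"
    and Q0: "poly Q 0 = (if degree ?D < degree ?N then 0 else 1)"
    using D0 by (auto simp: P_def Q_def poly_monom n_def max_def power_0_left)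
  show ?thesis
  proof (rule that[of P Q])
    show "poly P 0 \<noteq> 0 \<or> poly Q 0 \<noteq> 0" unfolding P0 Q0 by auto
    show Qn0: "Q \<noteq> 0" using rat_den_nonzero by (simp add: Q_def)
    show "order 0 Q = pole_order f x"
      using D0 Qn0 by (simp add: Q_def Infty order_mult order_0I n_def)
    show "rat_map f (local_chart x w) = (if poly Q w = 0 then Infty else Pt (poly P w / poly Q w))" for w
    proof (cases "w = 0")
      case True
      \<comment> \<open>The coefficient read off by \<open>rat_map\<close> at infinity is 0 when the
        numerator has smaller degree, in agreement with \<open>P0\<close>.\<close>
      then show ?thesis using lead_coeff_rat_den[of f] by (auto simp: Infty P0 Q0 coeff_eq_0 not_less)
    next
      case False
      then show ?thesis by (simp add: Infty P Q)
    qed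
  qed
qed

lemma local_chart_0: "local_chart x 0 = x"
  by (cases x) auto

lemma Pt_in_RP1_iff: "Pt z \<in> RP1 \<longleftrightarrow> z \<in> \<real>"
  by (auto simp: RP1_def Reals_def)

text \<open>Swapping \<open>P\<close> and \<open>Q\<close> at a pole makes \<open>B\<close> nonzero
  at the centre in all cases, so poles and other points are treated alike. As \<open>RP1\<close> is
  invariant under inversion, the locus is still where the quotient is real.\<close>

lemma local_expr_rational:
  obtains A B r where "r > 0" "\<And>w. w \<in> ball 0 r \<Longrightarrow> poly B w \<noteq> 0"
    "\<And>w. w \<in> ball 0 r \<Longrightarrow> local_expr f x w = poly A w / poly B w"
    "\<And>w. w \<in> ball 0 r \<Longrightarrow> local_chart x w \<in> real_locus f \<longleftrightarrow> poly A w / poly B w \<in> \<real>"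
    "x \<in> poles f \<Longrightarrow> A \<noteq> 0 \<and> poly A 0 = 0 \<and> order 0 A = pole_order f x"
proof -
  obtain P Q where PQ: "poly P 0 \<noteq> 0 \<or> poly Q 0 \<noteq> 0" "Q \<noteq> 0" "order 0 Q = pole_order f x"
    and map: "\<And>w. rat_map f (local_chart x w) = (if poly Q w = 0 then Infty else Pt (poly P w / poly Q w))"
    using rat_map_local_chart by metis
  have pole: "x \<in> poles f \<longleftrightarrow> poly Q 0 = 0"
    using map[of 0] by (auto simp: poles_def local_chart_0 split: if_splits)
  define A B where "A = (if x \<in> poles f then Q else P)" and "B = (if x \<in> poles f then P else Q)"
  have "poly B 0 \<noteq> 0" using PQ(1) pole by (auto simp: B_def)
  then have "\<exists>r>0. \<forall>w. dist w 0 < r \<longrightarrow> poly B w \<noteq> 0"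
    using continuous_at_avoid[of 0 "poly B" 0] by (simp add: dist_commute)
  then obtain r where r: "r > 0" "\<And>w. w \<in> ball 0 r \<Longrightarrow> poly B w \<noteq> 0"
    by (auto simp: dist_commute)
  show ?thesis
  proof (rule that[OF r])
    show "local_expr f x w = poly A w / poly B w" if "w \<in> ball 0 r" for w
      using r(2)[OF that] by (auto simp: local_expr_def map A_def B_def)
    show "local_chart x w \<in> real_locus f \<longleftrightarrow> poly A w / poly B w \<in> \<real>" if "w \<in> ball 0 r" for w
    proof -
      \<comment> \<open>This covers zero \<open>u\<close> or \<open>v\<close>, since division by
        zero gives 0.\<close>
      have "u / v \<in> \<real>" if "v / u \<in> \<real>" for u v :: complex
        using Reals_inverse[OF that] by (simp add: inverse_eq_divide)
      then have "u / v \<in> \<real> \<longleftrightarrow> v / u \<in> \<real>" for u v :: complex by blast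
      moreover have "Infty \<in> RP1" by (simp add: RP1_def)
      ultimately show ?thesis using r(2)[OF that]
        by (auto simp: real_locus_def map A_def B_def Pt_in_RP1_iff)
    qed
    show "A \<noteq> 0 \<and> poly A 0 = 0 \<and> order 0 A = pole_order f x" if "x \<in> poles f"
      using that PQ pole by (simp add: A_def)
  qed
qed

lemma local_expr_holomorphic:
  obtains r where "r > 0" "local_expr f x holomorphic_on ball 0 r"
    "\<And>w. w \<in> ball 0 r \<Longrightarrow> local_chart x w \<in> real_locus f \<longleftrightarrow> local_expr f x w \<in> \<real>"
proof -
  obtain A B r where r: "r > 0" "\<And>w. w \<in> ball 0 r \<Longrightarrow> poly B w \<noteq> 0"
    "\<And>w. w \<in> ball 0 r \<Longrightarrow> local_expr f x w = poly A w / poly B w"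
    "\<And>w. w \<in> ball 0 r \<Longrightarrow> local_chart x w \<in> real_locus f \<longleftrightarrow> poly A w / poly B w \<in> \<real>"
    using local_expr_rational by metis
  show ?thesis
  proof (rule that[OF r(1)])
    have "(\<lambda>w. poly A w / poly B w) holomorphic_on ball 0 r"
      using r(2) by (intro holomorphic_intros) auto
    then show "local_expr f x holomorphic_on ball 0 r"
      by (rule holomorphic_transform) (simp add: r(3))
  qed (use r(3,4) in simp)
qed

section \<open>Singular points as critical points\<close>

lemma critical_points_iff_deriv: "x \<in> critical_points f \<longleftrightarrow> deriv (local_expr f x) 0 = 0"
proof -
  obtain r where "r > 0" "local_expr f x holomorphic_on ball 0 r"
    using local_expr_holomorphic by metis
  then have "(local_expr f x has_field_derivative deriv (local_expr f x) 0) (at 0)"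
    using holomorphic_derivI[of _ "ball 0 r" 0] by simp
  then show ?thesis unfolding critical_points_def by (auto dest: DERIV_unique)
qed

text \<open>In the coordinate at \<open>x\<close> the locus is where the holomorphic
  \<open>local_expr f x\<close> is real, so the two lemmas on regular arcs apply.\<close>

lemma singular_points_real_locus:
  "singular_points (real_locus f) = real_locus f \<inter> critical_points f"
proof -
  have "regular_arc_at {w. local_chart x w \<in> real_locus f} 0 \<longleftrightarrow> x \<notin> critical_points f"
    if x: "x \<in> real_locus f" for x
  proof -
    obtain r where r: "r > 0" "local_expr f x holomorphic_on ball 0 r"
      "\<And>w. w \<in> ball 0 r \<Longrightarrow> local_chart x w \<in> real_locus f \<longleftrightarrow> local_expr f x w \<in> \<real>"
      using local_expr_holomorphic by metis
    have 0: "(0::complex) \<in> ball 0 r" using r(1) by simp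
    have X: "\<And>w. w \<in> ball 0 r \<Longrightarrow> w \<in> {w. local_chart x w \<in> real_locus f} \<longleftrightarrow> local_expr f x w \<in> \<real>"
      using r(3) by simp
    have "local_expr f x 0 \<in> \<real>" using X[OF 0] x by (simp add: local_chart_0)
    then show ?thesis
      using regular_arc_if_deriv_nonzero[OF r(2) open_ball 0 X]
        deriv_nonzero_if_regular_arc[OF r(2) open_ball 0 X]
      unfolding critical_points_iff_deriv by blast
  qed
  then show ?thesis unfolding singular_points_def by blast
qed

lemma poles_subset_real_locus: "poles f \<subseteq> real_locus f"
  by (auto simp: poles_def real_locus_def RP1_def)

text \<open>Near a pole \<open>1 / f\<close> is \<open>A / B\<close>, with \<open>A\<close>
  vanishing at 0 to the pole order. Its derivative at 0 is \<open>A'(0) / B(0)\<close>, and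
  differentiation lowers the order of \<open>A\<close> by one.\<close>

lemma critical_pole_iff:
  assumes "x \<in> poles f"
  shows "x \<in> critical_points f \<longleftrightarrow> pole_order f x \<ge> 2"
proof -
  obtain A B r where r: "r > 0" "\<And>w. w \<in> ball 0 r \<Longrightarrow> poly B w \<noteq> 0"
    and expr: "\<And>w. w \<in> ball 0 r \<Longrightarrow> local_expr f x w = poly A w / poly B w"
    and A: "A \<noteq> 0" "poly A 0 = 0" "order 0 A = pole_order f x"
    using local_expr_rational[of f x] assms by metis
  have B0: "poly B 0 \<noteq> 0" using r by simp
  have "((\<lambda>w. poly A w / poly B w) has_field_derivative poly (pderiv A) 0 / poly B 0) (at 0)"
    using B0 A(2) by (auto intro!: derivative_eq_intros poly_DERIV simp: field_simps)
  then have "(local_expr f x has_field_derivative poly (pderiv A) 0 / poly B 0) (at 0)"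
    by (rule has_field_derivative_transform_within_open[OF _ open_ball, of _ _ _ 0 r])
       (use r expr in auto)
  then have "deriv (local_expr f x) 0 = poly (pderiv A) 0 / poly B 0" by (rule DERIV_imp_deriv)
  then have "x \<in> critical_points f \<longleftrightarrow> poly (pderiv A) 0 = 0"
    using B0 by (simp add: critical_points_iff_deriv)
  moreover have "pderiv A \<noteq> 0"
    by (rule pderiv_nonzero_if_root[OF A(1,2)])
  moreover have "pole_order f x = Suc (order 0 (pderiv A))"
    using order_pderiv[OF A(1,2)] A(3) by simp
  ultimately show ?thesis by (auto simp: order_root)
qed

lemma finite_singularities_eq:
  "finite_singularities f = {x \<in> critical_points f - poles f. rat_map f x \<in> RP1}"
  unfolding finite_singularities_def singular_points_real_locus by (auto simp: real_locus_def)

lemma finite_singularities_iff: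
  "finite_singularities f \<noteq> {} \<longleftrightarrow> remaining_critical_values f \<inter> RP1 \<noteq> {}"
  by (auto simp: finite_singularities_eq remaining_critical_values_def)

text \<open>Poles lie on the locus and are critical exactly when multiple, so only critical points
  outside the poles can spoil the equality.\<close>

lemma only_forced_singularities_iff:
  "only_forced_singularities f \<longleftrightarrow> (\<forall>x \<in> critical_points f - poles f. rat_map f x \<notin> RP1)"
proof -
  have "\<And>x. x \<in> poles f \<Longrightarrow> x \<in> critical_points f \<longleftrightarrow> pole_order f x \<ge> 2"
    by (rule critical_pole_iff)
  moreover have "\<And>x. x \<in> real_locus f \<longleftrightarrow> rat_map f x \<in> RP1" by (simp add: real_locus_def)
  ultimately show ?thesis
    using poles_subset_real_locus[of f]
    unfolding only_forced_singularities_def singular_points_real_locus by blast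
qed

section \<open>Generic members of the three classes\<close>

lemma critical_finite_point:
  assumes "Pt z \<in> critical_points f" "Pt z \<notin> poles f"
  shows "poly (pderiv (rat_num f) * rat_den f - rat_num f * pderiv (rat_den f)) z = 0"
proof -
  let ?N = "rat_num f" and ?D = "rat_den f"
  have Dz: "poly ?D z \<noteq> 0" using assms(2) by (auto simp: poles_def)
  have op: "open {w. poly ?D (z + w) \<noteq> 0}"
    by (intro open_Collect_neq continuous_intros)
  have "(local_expr f (Pt z) has_field_derivative 0) (at 0)"
    using assms(1) by (simp add: critical_points_def)
  then have "((\<lambda>w. poly ?N (z + w) / poly ?D (z + w)) has_field_derivative 0) (at 0)"
    by (rule has_field_derivative_transform_within_open[OF _ op])
       (use Dz assms(2) in \<open>auto simp: local_expr_def\<close>)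
  moreover have "((\<lambda>w. poly ?N (z + w) / poly ?D (z + w)) has_field_derivative
      (poly (pderiv ?N) z * poly ?D z - poly ?N z * poly (pderiv ?D) z) / (poly ?D z * poly ?D z)) (at 0)"
    using Dz by (auto intro!: derivative_eq_intros DERIV_chain2[OF poly_DERIV])
  ultimately show ?thesis using Dz by (auto dest: DERIV_unique)
qed

section \<open>Real polynomials in the coefficients\<close>

text \<open>Closure under complex arithmetic and conjugation allows the exceptional sets to be
  described by complex expressions before real and imaginary parts are taken.\<close>

definition cpoly :: "('a::real_normed_vector \<Rightarrow> complex) \<Rightarrow> bool" where
  "cpoly f \<longleftrightarrow> real_polynomial_function (\<lambda>v. Re (f v)) \<and> real_polynomial_function (\<lambda>v. Im (f v))"

lemma cpoly_linear: "bounded_linear f \<Longrightarrow> cpoly f"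
  unfolding cpoly_def
  by (intro conjI real_polynomial_function.intros(1) bounded_linear_compose[OF bounded_linear_Re]
      bounded_linear_compose[OF bounded_linear_Im])

lemma cpoly_const: "cpoly (\<lambda>v. c)"
  by (auto simp: cpoly_def)

lemma cpoly_add: "cpoly f \<Longrightarrow> cpoly g \<Longrightarrow> cpoly (\<lambda>v. f v + g v)"
  and cpoly_diff: "cpoly f \<Longrightarrow> cpoly g \<Longrightarrow> cpoly (\<lambda>v. f v - g v)"
  and cpoly_mult: "cpoly f \<Longrightarrow> cpoly g \<Longrightarrow> cpoly (\<lambda>v. f v * g v)"
  and cpoly_uminus: "cpoly f \<Longrightarrow> cpoly (\<lambda>v. - f v)"
  and cpoly_cnj: "cpoly f \<Longrightarrow> cpoly (\<lambda>v. cnj (f v))"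
  by (auto simp: cpoly_def)

lemma cpoly_power: "cpoly f \<Longrightarrow> cpoly (\<lambda>v. f v ^ n)"
  by (induction n) (auto intro: cpoly_const cpoly_mult)

lemmas cpoly_intros = cpoly_const cpoly_add cpoly_diff cpoly_mult cpoly_uminus cpoly_cnj cpoly_power
  cpoly_linear bounded_linear_fst bounded_linear_snd
  bounded_linear_fst[THEN bounded_linear_compose] bounded_linear_snd[THEN bounded_linear_compose]

lemma real_polynomial_function_Re_Im:
  assumes "cpoly f"
  shows "real_polynomial_function (\<lambda>v. Re (f v))" "real_polynomial_function (\<lambda>v. Im (f v))"
  using assms by (simp_all add: cpoly_def)

lemmas real_poly_intros = real_polynomial_function_diff real_polynomial_function.intros(2-)
  real_polynomial_function_power real_polynomial_function_Re_Im cpoly_intros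

lemma generic_onI:
  assumes "real_polynomial_function P" "v0 \<in> S" "P v0 \<noteq> 0"
    and "\<And>v. v \<in> S \<Longrightarrow> \<not> Q v \<Longrightarrow> P v = 0"
  shows "generic_on S Q"
  using assms unfolding generic_on_def by blast

text \<open>Outside the poles the value infinity is not taken, which leaves the real numbers in
  \<open>RP1\<close>.\<close>

lemma real_critical_value:
  assumes "\<not> only_forced_singularities f"
  obtains x u where "x \<in> critical_points f" "x \<notin> poles f" "rat_map f x = Pt (of_real u)"
proof -
  obtain x where x: "x \<in> critical_points f" "x \<notin> poles f" "rat_map f x \<in> RP1"
    using assms unfolding only_forced_singularities_iff by blast
  then show ?thesis using that by (auto simp: RP1_def poles_def)
qed

text \<open>The left-hand side is the resultant of the real and imaginary parts of the quadratic.\<close>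

lemma resultant_real_imag_zero:
  fixes A B C :: complex and u :: real
  assumes "A * of_real u ^ 2 + B * of_real u + C = 0"
  shows "(Re A * Im C - Im A * Re C) ^ 2
    - (Re A * Im B - Im A * Re B) * (Re B * Im C - Im B * Re C) = 0"
proof -
  have "Re A * u ^ 2 + Re B * u + Re C = 0" "Im A * u ^ 2 + Im B * u + Im C = 0"
    using arg_cong[OF assms, of Re] arg_cong[OF assms, of Im] by (simp_all flip: of_real_power)
  \<comment> \<open>Solving for the constant terms turns the claim into a polynomial
    identity.\<close>
  then have C: "Re C = - (Re A * u ^ 2 + Re B * u)" "Im C = - (Im A * u ^ 2 + Im B * u)"
    by linarith+
  show ?thesis unfolding C by algebra
qed

text \<open>\<open>v\<close> is a critical value of the cubic iff the discriminant of \<open>a z\<^sup>3 + b z\<^sup>2 + c z + (d - v)\<close>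
  vanishes, which is a quadratic equation for \<open>v\<close>.\<close>

lemma generic_class_i: "generic_on coeffs_i (\<lambda>v. only_forced_singularities (class_i v))"
proof -
  let ?a = "\<lambda>v::complex \<times> complex \<times> complex \<times> complex. fst v"
    and ?b = "\<lambda>v::complex \<times> complex \<times> complex \<times> complex. fst (snd v)"
    and ?c = "\<lambda>v::complex \<times> complex \<times> complex \<times> complex. fst (snd (snd v))"
    and ?d = "\<lambda>v::complex \<times> complex \<times> complex \<times> complex. snd (snd (snd v))"
  \<comment> \<open>With \<open>e = d - v\<close> for the critical value \<open>v\<close>, the
    discriminant is \<open>- 27 a^2 e^2 + E e + b^2 c^2 - 4 a c^3\<close>; \<open>A\<close>,
    \<open>B\<close>, \<open>C\<close> are its coefficients as a polynomial in that value.\<close>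
  define E where "E = (\<lambda>v. 18 * ?a v * ?b v * ?c v - 4 * ?b v ^ 3)"
  define A where "A = (\<lambda>v. - 27 * ?a v ^ 2)"
  define B where "B = (\<lambda>v. 54 * ?a v ^ 2 * ?d v - E v)"
  define C where "C = (\<lambda>v. - 27 * ?a v ^ 2 * ?d v ^ 2 + E v * ?d v + ?b v ^ 2 * ?c v ^ 2 - 4 * ?a v * ?c v ^ 3)"
  have cp: "cpoly A" "cpoly B" "cpoly C"
    unfolding A_def B_def C_def E_def by (intro cpoly_intros)+
  show ?thesis
  proof (rule generic_onI)
    show "real_polynomial_function (\<lambda>v. (Re (A v) * Im (C v) - Im (A v) * Re (C v)) ^ 2
      - (Re (A v) * Im (B v) - Im (A v) * Re (B v)) * (Re (B v) * Im (C v) - Im (B v) * Re (C v)))"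
      by (intro real_poly_intros cp)
    \<comment> \<open>The cubic \<open>z^3 - 3 z + \<i>\<close> has critical points \<open>1\<close>
      and \<open>-1\<close>, with the non-real values \<open>\<i> - 2\<close> and
      \<open>\<i> + 2\<close>.\<close>
    show "(1, 0, -3, \<i>) \<in> coeffs_i" by (simp add: coeffs_i_def)
    show "(Re (A (1, 0, -3, \<i>)) * Im (C (1, 0, -3, \<i>)) - Im (A (1, 0, -3, \<i>)) * Re (C (1, 0, -3, \<i>))) ^ 2
      - (Re (A (1, 0, -3, \<i>)) * Im (B (1, 0, -3, \<i>)) - Im (A (1, 0, -3, \<i>)) * Re (B (1, 0, -3, \<i>)))
      * (Re (B (1, 0, -3, \<i>)) * Im (C (1, 0, -3, \<i>)) - Im (B (1, 0, -3, \<i>)) * Re (C (1, 0, -3, \<i>))) \<noteq> 0"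
      by (simp add: A_def B_def C_def E_def)
    fix v assume v: "v \<in> coeffs_i" "\<not> only_forced_singularities (class_i v)"
    obtain a b c d where abcd: "v = (a, b, c, d)" by (cases v)
    have a: "a \<noteq> 0" using v(1) by (simp add: abcd coeffs_i_def)
    obtain x u where x: "x \<in> critical_points (class_i v)" "x \<notin> poles (class_i v)"
      "rat_map (class_i v) x = Pt (of_real u)"
      using real_critical_value[OF v(2)] by metis
    obtain z where z: "x = Pt z" using x(2) poles_class_i[OF a, of b c d] by (cases x) (auto simp: abcd)
    have "c = - (3 * a * z ^ 2 + 2 * b * z)"
      using critical_finite_point[of z "class_i v"] x(1,2)
      by (simp add: z abcd rat_class_i pderiv_pCons) (simp add: algebra_simps power2_eq_square eq_neg_iff_add_eq_0)
    moreover have "complex_of_real u = a * z ^ 3 + b * z ^ 2 + c * z + d"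
      using x(3) by (simp add: z abcd rat_class_i algebra_simps power2_eq_square power3_eq_cube)
    ultimately have "A v * of_real u ^ 2 + B v * of_real u + C v = 0"
      unfolding A_def B_def C_def E_def abcd fst_conv snd_conv by algebra
    then show "(Re (A v) * Im (C v) - Im (A v) * Re (C v)) ^ 2
      - (Re (A v) * Im (B v) - Im (A v) * Re (B v)) * (Re (B v) * Im (C v) - Im (B v) * Re (C v)) = 0"
      by (rule resultant_real_imag_zero)
  qed
qed

text \<open>Apart from the pole, the critical points are infinity, with value \<open>c\<close>, and, if \<open>b \<noteq> 0\<close>,
  \<open>- 3 a / (2 b)\<close>, with value \<open>c + 4 b\<^sup>3 / (27 a\<^sup>2)\<close>.\<close>

lemma generic_class_ii: "generic_on coeffs_ii (\<lambda>v. only_forced_singularities (class_ii v))"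
proof -
  let ?a = "\<lambda>v::complex \<times> complex \<times> complex. fst v"
    and ?b = "\<lambda>v::complex \<times> complex \<times> complex. fst (snd v)"
    and ?c = "\<lambda>v::complex \<times> complex \<times> complex. snd (snd v)"
  \<comment> \<open>This is \<open>27 |a|^4\<close> times the critical value
    \<open>c + 4 b^3 / (27 a^2)\<close>: multiplying by \<open>cnj a ^ 2\<close> clears the
    denominator by a positive real factor and stays polynomial.\<close>
  define E where "E = (\<lambda>v. cnj (?a v) ^ 2 * (27 * ?c v * ?a v ^ 2 + 4 * ?b v ^ 3))"
  have cp: "cpoly E" "cpoly ?c" unfolding E_def by (intro cpoly_intros)+
  show ?thesis
  proof (rule generic_onI)
    show "real_polynomial_function (\<lambda>v. Im (?c v) * Im (E v))" by (intro real_poly_intros cp)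
    \<comment> \<open>For \<open>\<i> + 1 / z^3\<close> the only critical point besides the pole is
      infinity, with value \<open>\<i>\<close>.\<close>
    show "(1, 0, \<i>) \<in> coeffs_ii" by (simp add: coeffs_ii_def)
    show "Im (?c (1, 0, \<i>)) * Im (E (1, 0, \<i>)) \<noteq> 0" by (simp add: E_def)
    fix v assume v: "v \<in> coeffs_ii" "\<not> only_forced_singularities (class_ii v)"
    obtain a b c where abc: "v = (a, b, c)" by (cases v)
    have a: "a \<noteq> 0" using v(1) by (simp add: abc coeffs_ii_def)
    obtain x u where x: "x \<in> critical_points (class_ii v)" "x \<notin> poles (class_ii v)"
      "rat_map (class_ii v) x = Pt (of_real u)"
      using real_critical_value[OF v(2)] by metis
    show "Im (?c v) * Im (E v) = 0"
    proof (cases x)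
      case Infty
      then have "c = of_real u" using x(3) by (simp add: abc rat_class_ii[OF a] split: if_splits)
      then show ?thesis by (simp add: abc)
    next
      case (Pt z)
      then have z: "z \<noteq> 0" using x(2) poles_class_ii[OF a, of b c] by (auto simp: abc)
      have "- (a * 3) = b * (z * 2)"
        using critical_finite_point[of z "class_ii v"] x(1,2) z
        by (simp add: Pt abc rat_class_ii[OF a] pderiv_pCons) (simp add: algebra_simps power2_eq_square)
      then have 1: "2 * b * z + 3 * a = 0" by algebra
      have 2: "of_real u * z ^ 3 = a + b * z + c * z ^ 3"
        using x(3) z by (simp add: Pt abc rat_class_ii[OF a] field_simps power3_eq_cube)
      \<comment> \<open>Both sides reduce to expressions in \<open>a\<close>, \<open>c\<close>,
        \<open>z\<close> by \<open>b z = - 3 a / 2\<close>, which avoids dividing by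
        \<open>b\<close>.\<close>
      have "z ^ 3 * (27 * c * a ^ 2 + 4 * b ^ 3) = z ^ 3 * (27 * a ^ 2 * of_real u)"
        using 1 2 by algebra
      then have "27 * c * a ^ 2 + 4 * b ^ 3 = 27 * a ^ 2 * of_real u" using z by simp
      then have "E v = 27 * of_real u * ((a * cnj a) ^ 2)"
        by (simp add: E_def abc power_mult_distrib)
      also have "\<dots> = of_real (27 * u * (norm a ^ 2) ^ 2)" by (simp only: complex_norm_square[symmetric] of_real_mult of_real_power of_real_numeral)
      finally show ?thesis by (simp only: Im_complex_of_real mult_zero_right)
    qed
  qed
qed

text \<open>A critical value \<open>v\<close> satisfies \<open>4 (v - b)\<^sup>3 = K\<close> with \<open>K = 27 a\<^sup>2 c\<close>.  If it is real, then
  \<open>v - b = u - i \<beta>\<close> with \<open>\<beta> = Im b\<close>, and eliminating \<open>u\<close> from the imaginary part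
  \<open>12 \<beta> u\<^sup>2 = 4 \<beta>\<^sup>3 - Im K\<close> and the square of the real part \<open>4 u (u\<^sup>2 - 3 \<beta>\<^sup>2) = Re K\<close> gives the
  polynomial below.\<close>

lemma generic_class_iii: "generic_on coeffs_iii (\<lambda>v. only_forced_singularities (class_iii v))"
proof -
  let ?a = "\<lambda>v::complex \<times> complex \<times> complex. fst v"
    and ?b = "\<lambda>v::complex \<times> complex \<times> complex. fst (snd v)"
    and ?c = "\<lambda>v::complex \<times> complex \<times> complex. snd (snd v)"
  define K where "K = (\<lambda>v. 27 * ?a v ^ 2 * ?c v)"
  \<comment> \<open>Put \<open>X = 4 \<beta>^3 - Im K = 12 \<beta> u^2\<close>. Multiplying the
    squared real part by \<open>108 \<beta>^3\<close> turns its right-hand side into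
    \<open>X (X - 36 \<beta>^3)^2\<close>.\<close>
  define P where "P = (\<lambda>v. (4 * Im (?b v) ^ 3 - Im (K v)) * (4 * Im (?b v) ^ 3 - Im (K v) - 36 * Im (?b v) ^ 3) ^ 2
    - 108 * Im (?b v) ^ 3 * Re (K v) ^ 2)"
  have cp: "cpoly K" "cpoly ?b" unfolding K_def by (intro cpoly_intros)+
  show ?thesis
  proof (rule generic_onI)
    show "real_polynomial_function P" unfolding P_def by (intro real_poly_intros cp)
    \<comment> \<open>For \<open>z + \<i> / z^2\<close> one has \<open>\<beta> = 0\<close> and
      \<open>K = 27 \<i>\<close>, so only the cube of \<open>- Im K\<close> survives in
      \<open>P\<close>.\<close>
    show "(1, 0, \<i>) \<in> coeffs_iii" by (simp add: coeffs_iii_def)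
    show "P (1, 0, \<i>) \<noteq> 0" by (simp add: P_def K_def)
    fix v assume v: "v \<in> coeffs_iii" "\<not> only_forced_singularities (class_iii v)"
    obtain a b c where abc: "v = (a, b, c)" by (cases v)
    have ac: "a * c \<noteq> 0" and c: "c \<noteq> 0" using v(1) by (simp_all add: abc coeffs_iii_def)
    obtain x r where x: "x \<in> critical_points (class_iii v)" "x \<notin> poles (class_iii v)"
      "rat_map (class_iii v) x = Pt (of_real r)"
      using real_critical_value[OF v(2)] by metis
    obtain z where z: "x = Pt z" "z \<noteq> 0"
      using x(2) poles_class_iii[OF ac, of b] by (cases x) (auto simp: abc)
    have "z * (a * z ^ 3 - 2 * c) = 0"
      using critical_finite_point[of z "class_iii v"] x(1,2)
      by (simp add: z abc rat_class_iii[OF c] pderiv_pCons) (simp add: algebra_simps power2_eq_square power3_eq_cube)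
    then have 1: "a * z ^ 3 = 2 * c" using z by simp
    have 2: "of_real r * z ^ 2 = c + b * z ^ 2 + a * z ^ 3"
      using x(3) z by (simp add: abc rat_class_iii[OF c] field_simps power2_eq_square power3_eq_cube)
    \<comment> \<open>The critical equation \<open>c = a z^3 / 2\<close> gives the value
      \<open>b + 3 a z / 2\<close>; cubing and using the equation again removes
      \<open>z\<close>.\<close>
    have "z ^ 2 * (2 * (of_real r - b)) = z ^ 2 * (3 * a * z)" using 1 2 by algebra
    then have "2 * (of_real r - b) = 3 * a * z" using z by simp
    then have K: "K v = 4 * (of_real r - b) ^ 3"
      using 1 unfolding K_def abc fst_conv snd_conv by algebra
    define \<beta> u where "\<beta> = Im b" and "u = r - Re b"
    have "of_real r - b = Complex u (- \<beta>)" by (simp add: complex_eq_iff \<beta>_def u_def)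
    then have KRI: "Re (K v) = 4 * u * (u ^ 2 - 3 * \<beta> ^ 2)" "Im (K v) = 4 * \<beta> ^ 3 - 12 * \<beta> * u ^ 2"
      unfolding K by (simp_all add: power3_eq_cube power2_eq_square algebra_simps)
    have b: "Im (?b v) = \<beta>" by (simp add: abc \<beta>_def)
    show "P v = 0" unfolding P_def b KRI by algebra
  qed
qed

theorem proposition9p3:
  shows "(\<forall>f. rat_exact f \<and> rat_degree f = 3 \<longrightarrow>
            (\<exists>t g. g = rat_translate t f \<and>
               (g \<in> class_i ` coeffs_i
                \<or> poles g = {Pt 0} \<and> pole_order g (Pt 0) = 3 \<and> g \<in> class_ii ` coeffs_ii
                \<or> poles g = {Pt 0, Infty} \<and> pole_order g (Pt 0) = 2 \<and> pole_order g Infty = 1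
                    \<and> g \<in> class_iii ` coeffs_iii)))
       \<and> generic_on coeffs_i (\<lambda>v. only_forced_singularities (class_i v))
       \<and> generic_on coeffs_ii (\<lambda>v. only_forced_singularities (class_ii v))
       \<and> generic_on coeffs_iii (\<lambda>v. only_forced_singularities (class_iii v))
       \<and> (\<forall>f. rat_exact f \<and> rat_degree f = 3 \<longrightarrow>
            (finite_singularities f \<noteq> {} \<longleftrightarrow> remaining_critical_values f \<inter> RP1 \<noteq> {}))"
proof (intro conjI allI impI)
  fix f assume "rat_exact f \<and> rat_degree f = 3"
  then show "\<exists>t g. g = rat_translate t f \<and>
               (g \<in> class_i ` coeffs_i
                \<or> poles g = {Pt 0} \<and> pole_order g (Pt 0) = 3 \<and> g \<in> class_ii ` coeffs_ii
                \<or> poles g = {Pt 0, Infty} \<and> pole_order g (Pt 0) = 2 \<and> pole_order g Infty = 1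
                    \<and> g \<in> class_iii ` coeffs_iii)"
    by (elim conjE) (rule exact_degree_3_classification)
qed (rule generic_class_i generic_class_ii generic_class_iii finite_singularities_iff)+

end
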